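(* (Caterpillar intermediate value theorem.) Let $W$ be a closed caterpillar walk on a graph $G$. Then $W$ includes a closed subwalk of length $2s$ for each $s=1,\dots,|W|/2$.
   Context: A walk is an alternating sequence of vertices and edges, each edge preceded and followed by its endpoints; its length $|W|$ is the number of edges counted with repetition; it is closed if first and last vertices coincide, and closed walks differing only in the choice of initial vertex are identified. A subwalk of a closed walk $W=(v_0,\dots,v_{r}=v_0)$ is a walk formed by (cyclically) consecutive entries of $W$, i.e. $(v_i,v_{i+1},\dots,v_{i+\ell})$ with indices mod $r$. The graph underlying a walk is the subgraph formed by its vertices and edges. A caterpillar is a tree which becomes a path on removal of its leaves; a walk is a caterpillar walk if its underlying graph is a caterpillar. *)

theory Defs
  imports Main
begin

text \<open>
  Graphs are undirected and may have loops and parallel edges; an edge is mapped to its set of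
  one or two endpoints. Simple graphs are the instance where edges are two-element vertex sets
  and \<^term>\<open>ends\<close> is the identity.
\<close>

record ('v, 'e) ugraph =
  verts :: "'v set"
  edges :: "'e set"
  ends :: "'e \<Rightarrow> 'v set"

definition wf_ugraph :: "('v, 'e) ugraph \<Rightarrow> bool" where
  "wf_ugraph G \<longleftrightarrow>
     (\<forall>e \<in> edges G. ends G e \<subseteq> verts G \<and> (card (ends G e) = 1 \<or> card (ends G e) = 2))"

text \<open>
  The alternating sequence $v_0, e_0, v_1, \ldots, e_{r-1}, v_r$ is stored as the pair
  $([v_0, \ldots, v_r], [e_0, \ldots, e_{r-1}])$.
\<close>

type_synonym ('v, 'e) walk = "'v list \<times> 'e list"

abbreviation wverts :: "('v, 'e) walk \<Rightarrow> 'v list" where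
  "wverts W \<equiv> fst W"

abbreviation wedges :: "('v, 'e) walk \<Rightarrow> 'e list" where
  "wedges W \<equiv> snd W"

definition walk_length :: "('v, 'e) walk \<Rightarrow> nat" where
  "walk_length W = length (wedges W)"

definition is_walk :: "('v, 'e) ugraph \<Rightarrow> ('v, 'e) walk \<Rightarrow> bool" where
  "is_walk G W \<longleftrightarrow>
     length (wverts W) = Suc (length (wedges W)) \<and>
     set (wverts W) \<subseteq> verts G \<and> set (wedges W) \<subseteq> edges G \<and>
     (\<forall>i < length (wedges W). ends G (wedges W ! i) = {wverts W ! i, wverts W ! Suc i})"

definition closed_walk :: "('v, 'e) ugraph \<Rightarrow> ('v, 'e) walk \<Rightarrow> bool" where
  "closed_walk G W \<longleftrightarrow> is_walk G W \<and> hd (wverts W) = last (wverts W)"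

text \<open>
  Subwalks of a closed walk $W$ with $r = |W|$: since $v_r = v_0$, indices are read modulo $r$.
  The relation is therefore unaffected by the choice of the initial vertex of $W$. For $r = 0$
  the only subwalk is $W$ itself (recall that \<^prop>\<open>(n::nat) mod 0 = n\<close>).
\<close>

definition closed_walk_segment :: "('v, 'e) walk \<Rightarrow> nat \<Rightarrow> nat \<Rightarrow> ('v, 'e) walk" where
  "closed_walk_segment W i l =
     (map (\<lambda>j. wverts W ! ((i + j) mod walk_length W)) [0..<Suc l],
      map (\<lambda>j. wedges W ! ((i + j) mod walk_length W)) [0..<l])"

definition subwalk_of_closed :: "('v, 'e) walk \<Rightarrow> ('v, 'e) walk \<Rightarrow> bool" where
  "subwalk_of_closed U W \<longleftrightarrow>
     (\<exists>i l. i \<le> walk_length W \<and> l \<le> walk_length W \<and> U = closed_walk_segment W i l)"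

definition underlying_graph :: "('v, 'e) ugraph \<Rightarrow> ('v, 'e) walk \<Rightarrow> ('v, 'e) ugraph" where
  "underlying_graph G W =
     \<lparr>verts = set (wverts W), edges = set (wedges W), ends = ends G\<rparr>"

definition connected_ugraph :: "('v, 'e) ugraph \<Rightarrow> bool" where
  "connected_ugraph G \<longleftrightarrow>
     verts G \<noteq> {} \<and>
     (\<forall>u \<in> verts G. \<forall>v \<in> verts G.
        \<exists>W. is_walk G W \<and> hd (wverts W) = u \<and> last (wverts W) = v)"

text \<open>
  Distinctness of the edges excludes going back and forth along one edge; loops and pairs of
  parallel edges do count as cycles.
\<close>

definition is_cycle :: "('v, 'e) ugraph \<Rightarrow> ('v, 'e) walk \<Rightarrow> bool" where
  "is_cycle G C \<longleftrightarrow>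
     closed_walk G C \<and> walk_length C \<ge> 1 \<and>
     distinct (tl (wverts C)) \<and> distinct (wedges C)"

definition is_tree :: "('v, 'e) ugraph \<Rightarrow> bool" where
  "is_tree G \<longleftrightarrow> wf_ugraph G \<and> connected_ugraph G \<and> (\<nexists>C. is_cycle G C)"

text \<open>Used for trees only, so that loops need not be counted twice in the degree.\<close>

definition leaves :: "('v, 'e) ugraph \<Rightarrow> 'v set" where
  "leaves G = {v \<in> verts G. card {e \<in> edges G. v \<in> ends G e} = 1}"

definition remove_verts :: "('v, 'e) ugraph \<Rightarrow> 'v set \<Rightarrow> ('v, 'e) ugraph" where
  "remove_verts G S =
     \<lparr>verts = verts G - S, edges = {e \<in> edges G. ends G e \<inter> S = {}}, ends = ends G\<rparr>"

text \<open>
  The graph without vertices counts as a (degenerate) path, so that the tree with a single edge,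
  both of whose vertices are leaves, is a caterpillar.
\<close>

definition is_path_graph :: "('v, 'e) ugraph \<Rightarrow> bool" where
  "is_path_graph G \<longleftrightarrow>
     (verts G = {} \<and> edges G = {}) \<or>
     (\<exists>P. is_walk G P \<and> distinct (wverts P) \<and>
          set (wverts P) = verts G \<and> set (wedges P) = edges G)"

definition is_caterpillar :: "('v, 'e) ugraph \<Rightarrow> bool" where
  "is_caterpillar G \<longleftrightarrow> is_tree G \<and> is_path_graph (remove_verts G (leaves G))"

definition caterpillar_walk :: "('v, 'e) ugraph \<Rightarrow> ('v, 'e) walk \<Rightarrow> bool" where
  "caterpillar_walk G W \<longleftrightarrow> is_walk G W \<and> is_caterpillar (underlying_graph G W)"

end

theory Submission
  imports Defs
begin

text \<open>
  A caterpillar can be drawn without crossings between two parallel lines, one for each colour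
  class of its bipartition. If the walk \<open>v\<close> never returned after exactly \<open>2s\<close> steps, then
  \<open>v i\<close> and \<open>v (i + 2s)\<close> would always be distinct points of the same line. As edges do not
  cross, which of the two comes first cannot change when \<open>i\<close> is increased, so the sequence
  \<open>v 0\<close>, \<open>v (2s)\<close>, \<open>v (4s)\<close>, \<dots> would be strictly monotone in the drawing. This is
  impossible for a periodic sequence.
\<close>

text \<open>\<open>c\<close> selects the line and \<open>x\<close> the place on it. As
  \<open>{u, w}\<close> can be read in both orders, every condition covers both orientations of an
  edge. The last inequality is weak because two edges may share an endpoint.\<close>

definition noncrossing_layout ::
    "('v, 'e) ugraph \<Rightarrow> ('v \<Rightarrow> bool) \<Rightarrow> ('v \<Rightarrow> nat) \<Rightarrow> bool" where
  "noncrossing_layout G c x \<longleftrightarrow>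
     inj_on x (verts G) \<and>
     (\<forall>e \<in> edges G. \<forall>u w. ends G e = {u, w} \<longrightarrow> c w = (\<not> c u)) \<and>
     (\<forall>e \<in> edges G. \<forall>e' \<in> edges G. \<forall>u w u' w'.
        ends G e = {u, w} \<longrightarrow> ends G e' = {u', w'} \<longrightarrow> c u = c u' \<longrightarrow> x u < x u' \<longrightarrow> x w \<le> x w')"

section \<open>Periodic sequences\<close>

lemma periodic_mult:
  fixes f :: "nat \<Rightarrow> 'a"
  assumes "\<And>i. f (i + r) = f i"
  shows "f (i + k * r) = f i"
proof (induction k)
  case (Suc k)
  then show ?case using assms[of "i + k * r"] by (simp add: ac_simps)
qed simp

text \<open>After \<open>r\<close> shifts by \<open>d\<close> the index has moved by a multiple of
  the period, so a strict increase would end at its starting value.\<close>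

lemma periodic_not_shift_increasing:
  fixes f :: "nat \<Rightarrow> nat"
  assumes "0 < r" and "\<And>i. f (i + r) = f i" and "\<And>i. f i < f (i + d)"
  shows False
proof -
  have "strict_mono (\<lambda>k. f (k * d))"
    unfolding strict_mono_Suc_iff using assms(3) by (metis add.commute mult_Suc)
  then have "f (0 * d) < f (r * d)"
    using assms(1) by (rule strict_monoD)
  moreover have "f (r * d) = f 0"
    using periodic_mult[of f r 0 d, OF assms(2)] by (simp add: mult.commute)
  ultimately show False by simp
qed

text \<open>A periodic sequence has a bound \<open>b\<close>, and \<open>b - f i\<close> turns
  decrease into increase; the bound keeps truncated subtraction strict.\<close>

lemma periodic_not_shift_decreasing:
  fixes f :: "nat \<Rightarrow> nat"
  assumes "0 < r" and "\<And>i. f (i + r) = f i" and "\<And>i. f (i + d) < f i"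
  shows False
proof -
  obtain b where b: "\<And>i. f i \<le> b"
  proof
    fix i
    have "f i = f (i mod r)"
      using periodic_mult[of f r "i mod r" "i div r", OF assms(2)] by simp
    also have "\<dots> \<le> Max (f ` {..<r})"
      using assms(1) by (intro Max_ge) auto
    finally show "f i \<le> Max (f ` {..<r})" .
  qed
  show False
  proof (rule periodic_not_shift_increasing[of r "\<lambda>i. b - f i" d])
    show "b - f i < b - f (i + d)" for i
      using assms(3)[of i] b[of i] by linarith
  qed (use assms in auto)
qed

section \<open>Closed walks as periodic sequences\<close>

text \<open>Only the last edge needs care: it ends at index \<open>?r\<close>, which reduces to 0,
  and closedness identifies the two vertices.\<close>

lemma closed_walk_ends_mod:
  assumes "closed_walk G W" and "0 < walk_length W"
  shows "ends G (wedges W ! (i mod walk_length W)) =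
    {wverts W ! (i mod walk_length W), wverts W ! (Suc i mod walk_length W)}"
proof -
  let ?r = "walk_length W"
  have len: "length (wverts W) = Suc ?r"
    using assms by (auto simp: closed_walk_def is_walk_def walk_length_def)
  then have "wverts W \<noteq> []" by auto
  then have "wverts W ! ?r = wverts W ! 0"
    using assms len by (auto simp: closed_walk_def hd_conv_nth last_conv_nth)
  then have "wverts W ! Suc (i mod ?r) = wverts W ! (Suc i mod ?r)"
    by (auto simp: mod_Suc)
  moreover have "i mod ?r < ?r" using assms by simp
  ultimately show ?thesis
    using assms by (auto simp: closed_walk_def is_walk_def walk_length_def)
qed

lemma walk_length_segment [simp]: "walk_length (closed_walk_segment W i l) = l"
  by (simp add: closed_walk_segment_def walk_length_def)

lemma is_walk_segment:
  assumes "closed_walk G W" and "0 < walk_length W"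
  shows "is_walk G (closed_walk_segment W i l)"
proof -
  let ?r = "walk_length W"
  have "wverts W ! (j mod ?r) \<in> verts G" and "wedges W ! (j mod ?r) \<in> edges G" for j
  proof -
    have "j mod ?r < ?r" using assms by simp
    then show "wverts W ! (j mod ?r) \<in> verts G" and "wedges W ! (j mod ?r) \<in> edges G"
      using assms nth_mem[of "j mod ?r" "wverts W"] nth_mem[of "j mod ?r" "wedges W"]
      by (auto simp: closed_walk_def is_walk_def walk_length_def simp del: nth_mem)
  qed
  then show ?thesis
    using closed_walk_ends_mod[OF assms]
    by (auto simp: is_walk_def closed_walk_segment_def simp del: upt_Suc)
qed

lemma closed_walk_segment_closed:
  assumes "closed_walk G W" and "0 < walk_length W"
    and "wverts W ! (i mod walk_length W) = wverts W ! ((i + l) mod walk_length W)"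
  shows "closed_walk G (closed_walk_segment W i l)"
proof -
  have "hd (wverts (closed_walk_segment W i l)) = wverts W ! (i mod walk_length W)"
    by (simp add: closed_walk_segment_def hd_map del: upt_Suc)
  moreover have "last (wverts (closed_walk_segment W i l)) = wverts W ! ((i + l) mod walk_length W)"
    by (simp add: closed_walk_segment_def last_map)
  ultimately show ?thesis
    using assms is_walk_segment[OF assms(1,2)] by (simp add: closed_walk_def)
qed

section \<open>Return after exactly \<open>2 * s\<close> steps\<close>

lemma noncrossing_layout_return:
  assumes W: "closed_walk G W" and r: "0 < walk_length W"
    and layout: "noncrossing_layout (underlying_graph G W) c x"
  shows "\<exists>i < walk_length W. wverts W ! (i mod walk_length W) =
    wverts W ! ((i + 2 * s) mod walk_length W)"
proof (rule ccontr)
  let ?r = "walk_length W"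
  define v where "v i = wverts W ! (i mod ?r)" for i
  assume contr: "\<not> ?thesis"
  have periodic: "v (i + ?r) = v i" for i by (simp add: v_def)
  \<comment> \<open>The negated claim covers starts below \<open>?r\<close> only; periodicity
    extends it to all \<open>i\<close>.\<close>
  have ne: "v i \<noteq> v (i + 2 * s)" for i
  proof -
    have "i mod ?r < ?r" using r by simp
    then have "v (i mod ?r) \<noteq> v (i mod ?r + 2 * s)"
      using contr by (auto simp: v_def)
    then show ?thesis by (simp add: v_def mod_add_left_eq)
  qed
  let ?H = "underlying_graph G W"
  have mod_less: "i mod ?r < ?r" for i using r by simp
  have edge: "wedges W ! (i mod ?r) \<in> edges ?H" for i
    using mod_less[of i] by (simp add: underlying_graph_def walk_length_def)
  have ends: "ends ?H (wedges W ! (i mod ?r)) = {v i, v (Suc i)}" for i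
    using closed_walk_ends_mod[OF W r] by (simp add: underlying_graph_def v_def)
  have vert: "v i \<in> verts ?H" for i
    using W mod_less[of i]
    by (simp add: underlying_graph_def v_def closed_walk_def is_walk_def walk_length_def)
  have "c (v (Suc i)) = (\<not> c (v i))" for i
    using layout edge[of i] ends[of i] unfolding noncrossing_layout_def by blast
  then have col: "c (v (i + 2 * s)) = c (v i)" for i
    by (induction s) auto
  have cross: "x (v (Suc i)) \<le> x (v (Suc j))"
    if "c (v i) = c (v j)" "x (v i) < x (v j)" for i j
    using layout edge[of i] ends[of i] edge[of j] ends[of j] that
    unfolding noncrossing_layout_def by blast
  \<comment> \<open>This upgrades the weak inequality of \<open>cross\<close> to a strict one, so
    the order at \<open>i = 0\<close> persists for all \<open>i\<close>.\<close>
  have xne: "x (v i) \<noteq> x (v (i + 2 * s))" for i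
    using layout ne[of i] vert unfolding noncrossing_layout_def by (meson inj_onD)
  show False
  proof (cases "x (v 0) < x (v (0 + 2 * s))")
    case True
    have "x (v i) < x (v (i + 2 * s))" for i
    proof (induction i)
      case (Suc i)
      then show ?case
        using cross[of i "i + 2 * s"] col[of i] xne[of "Suc i"] by simp
    qed (rule True)
    then show False
      using periodic_not_shift_increasing[of ?r "\<lambda>i. x (v i)" "2 * s"] r periodic by simp
  next
    case False
    have "x (v (i + 2 * s)) < x (v i)" for i
    proof (induction i)
      case (Suc i)
      then show ?case
        using cross[of "i + 2 * s" i] col[of i] xne[of "Suc i"] by simp
    qed (use False xne[of 0] in simp)
    then show False
      using periodic_not_shift_decreasing[of ?r "\<lambda>i. x (v i)" "2 * s"] r periodic by simp
  qed
qed

section \<open>Noncrossing layouts of caterpillars\<close>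

text \<open>A loop is a cycle of length one in the sense of \<open>is_cycle\<close>.\<close>

lemma tree_no_loop:
  assumes "is_tree G" and "e \<in> edges G" and "ends G e = {v, w}"
  shows "v \<noteq> w"
proof
  assume "v = w"
  then have "is_cycle G ([v, v], [e])"
    using assms
    by (auto simp: is_cycle_def closed_walk_def is_walk_def walk_length_def is_tree_def
        wf_ugraph_def)
  then show False using assms by (auto simp: is_tree_def)
qed

lemma leaf_edge_unique:
  assumes "v \<in> leaves G" and "e \<in> edges G" "v \<in> ends G e" and "e' \<in> edges G" "v \<in> ends G e'"
  shows "e = e'"
proof -
  from assms(1) obtain e0 where e0: "{e \<in> edges G. v \<in> ends G e} = {e0}"
    unfolding leaves_def using card_1_singletonE by blast
  have "e \<in> {e \<in> edges G. v \<in> ends G e}" "e' \<in> {e \<in> edges G. v \<in> ends G e}"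
    using assms by simp_all
  then show ?thesis unfolding e0 by simp
qed

text \<open>At both \<open>u\<close> and \<open>w\<close> the only incident edge is
  \<open>e\<close>, so a walk starting at \<open>u\<close> can only go back and forth along
  \<open>e\<close>.\<close>

lemma connected_leaf_edge_verts:
  assumes conn: "connected_ugraph G"
    and e: "e \<in> edges G" "ends G e = {u, w}" and u: "u \<in> leaves G" and w: "w \<in> leaves G"
  shows "verts G \<subseteq> {u, w}"
proof
  fix v assume v: "v \<in> verts G"
  have "u \<in> verts G" using u by (simp add: leaves_def)
  with conn v obtain P where P: "is_walk G P" "hd (wverts P) = u" "last (wverts P) = v"
    unfolding connected_ugraph_def by blast
  have len: "length (wverts P) = Suc (length (wedges P))"
    using P by (simp add: is_walk_def)
  then have ne: "wverts P \<noteq> []" by auto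
  have "i \<le> length (wedges P) \<Longrightarrow> wverts P ! i \<in> {u, w}" for i
  proof (induction i)
    case 0
    then show ?case using P ne by (simp add: hd_conv_nth)
  next
    case (Suc i)
    let ?e = "wedges P ! i"
    have *: "?e \<in> edges G" "ends G ?e = {wverts P ! i, wverts P ! Suc i}"
      using P Suc.prems by (auto simp: is_walk_def)
    then have "?e = e"
      using leaf_edge_unique[OF u, of ?e e] leaf_edge_unique[OF w, of ?e e] e Suc by auto
    then show ?case using * e by auto
  qed
  from this[of "length (wedges P)"] show "v \<in> {u, w}"
    using P ne len by (simp add: last_conv_nth)
qed

text \<open>This serves the caterpillar without a spine. Here \<open>c\<close> determines
  \<open>x\<close>, so the crossing condition is vacuous.\<close>

lemma single_edge_layout:
  assumes tree: "is_tree G" and verts: "verts G \<subseteq> {u, w}"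
  shows "noncrossing_layout G (\<lambda>v. v = u) (\<lambda>v. if v = u then 0 else 1)"
proof -
  have *: "a \<in> {u, w} \<and> b \<in> {u, w} \<and> a \<noteq> b" if "e \<in> edges G" "ends G e = {a, b}" for e a b
    using tree_no_loop[OF tree that] that tree verts
    by (fastforce simp: is_tree_def wf_ugraph_def)
  show ?thesis
    unfolding noncrossing_layout_def
  proof (intro conjI ballI allI impI)
    show "inj_on (\<lambda>v. if v = u then 0 else 1 :: nat) (verts G)"
      using verts by (auto simp: inj_on_def)
  next
    fix e a b assume "e \<in> edges G" "ends G e = {a, b}"
    from *[OF this] show "(b = u) = (a \<noteq> u)" by auto
  qed (auto split: if_splits)
qed

text \<open>
  The vertex \<open>j\<close> of the spine is placed at \<open>j * N\<close> and the leaves attached to it strictly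
  between \<open>j * N\<close> and \<open>(j + 1) * N\<close>, hence between its two neighbours on the spine, which
  lie on the same line as these leaves.
\<close>

lemma caterpillar_spine_layout:
  assumes fin: "finite (verts G)" and tree: "is_tree G"
    and P: "is_walk (remove_verts G (leaves G)) P" "distinct (wverts P)"
      "set (wverts P) = verts G - leaves G"
      "set (wedges P) = edges (remove_verts G (leaves G))"
    and two_leaves: "\<And>e u w. e \<in> edges G \<Longrightarrow> ends G e = {u, w} \<Longrightarrow> u \<in> leaves G \<Longrightarrow> w \<notin> leaves G"
  shows "\<exists>c x. noncrossing_layout G c x"
proof -
  let ?L = "leaves G" and ?p = "wverts P"
  obtain g :: "'a \<Rightarrow> nat" and n where g: "g ` verts G = {i. i < n}" "inj_on g (verts G)"
    using finite_imp_inj_to_nat_seg[OF fin] by auto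
  \<comment> \<open>Leaf offsets \<open>Suc (g v)\<close> lie between 1 and \<open>n\<close>, so
    with blocks of length \<open>n + 1\<close> quotient and remainder of \<open>x v\<close> recover
    \<open>pos v\<close> and \<open>off v\<close>.\<close>
  define N where "N = Suc n"
  define nb where "nb l = (THE w. \<exists>e \<in> edges G. ends G e = {l, w})" for l
  define idx where "idx v = (THE j. j < length ?p \<and> ?p ! j = v)" for v
  define pos where "pos v = (if v \<in> ?L then idx (nb v) else idx v)" for v
  define off where "off v = (if v \<in> ?L then Suc (g v) else 0)" for v
  \<comment> \<open>Colours alternate along the spine, and a leaf gets the colour opposite to its
    neighbour, with which it shares \<open>pos\<close>.\<close>
  define c where "c v = (even (pos v) = (v \<in> ?L))" for v
  define x where "x v = pos v * N + off v" for v

  have idx_nth: "idx (?p ! j) = j" if "j < length ?p" for j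
    unfolding idx_def using that P(2) by (intro the_equality) (auto simp: nth_eq_iff_index_eq)
  have nth_idx: "?p ! idx v = v" if "v \<in> verts G" "v \<notin> ?L" for v
    using that P(3) idx_nth by (metis DiffI in_set_conv_nth)
  have off: "off v < N" if "v \<in> verts G" for v
    using that g by (auto simp: off_def N_def)
  have x_div: "x v div N = pos v" and x_mod: "x v mod N = off v" if "v \<in> verts G" for v
    using off[OF that] by (simp_all add: x_def)
  \<comment> \<open>Offset 0 marks spine vertices, which \<open>pos\<close> separates; leaves are
    separated by \<open>g\<close> through their offsets.\<close>
  have "v = w" if "v \<in> verts G" "w \<in> verts G" "x v = x w" for v w
  proof -
    have pos: "pos v = pos w" and off: "off v = off w"
      using x_div[of v] x_div[of w] x_mod[of v] x_mod[of w] that by simp_all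
    show ?thesis
    proof (cases "v \<in> ?L")
      case True
      then show ?thesis
        using off that g(2) by (auto simp: off_def inj_on_def split: if_splits)
    next
      case False
      moreover from this have "w \<notin> ?L" using off by (auto simp: off_def split: if_splits)
      ultimately show ?thesis
        using pos that nth_idx unfolding pos_def by metis
    qed
  qed
  then have inj: "inj_on x (verts G)" by (auto intro: inj_onI)
  have nb: "nb l = w" if "l \<in> ?L" "e \<in> edges G" "ends G e = {l, w}" for l w e
    unfolding nb_def
  proof (rule the_equality)
    show "\<exists>e \<in> edges G. ends G e = {l, w}" using that by blast
    fix w' assume "\<exists>e \<in> edges G. ends G e = {l, w'}"
    then obtain e' where "e' \<in> edges G" "ends G e' = {l, w'}" by blast
    moreover from this have "e' = e" using leaf_edge_unique[OF that(1)] that by blast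
    ultimately show "w' = w" using that by (auto simp: doubleton_eq_iff)
  qed
  have edge: "u \<in> verts G \<and> w \<in> verts G \<and>
      (u \<in> ?L \<and> w \<notin> ?L \<and> pos u = pos w \<or> u \<notin> ?L \<and> w \<in> ?L \<and> pos u = pos w \<or>
       u \<notin> ?L \<and> w \<notin> ?L \<and> (pos w = Suc (pos u) \<or> pos u = Suc (pos w)))"
    if e: "e \<in> edges G" "ends G e = {u, w}" for e u w
  proof -
    have e': "ends G e = {w, u}" using e by auto
    have "u \<in> verts G" "w \<in> verts G"
      using tree e by (auto simp: is_tree_def wf_ugraph_def)
    moreover have "pos w = Suc (pos u) \<or> pos u = Suc (pos w)" if "u \<notin> ?L" "w \<notin> ?L"
    proof -
      have "e \<in> set (wedges P)" using P(4) e that by (auto simp: remove_verts_def)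
      then obtain j where j: "j < length (wedges P)" "e = wedges P ! j"
        by (auto simp: in_set_conv_nth)
      then have "{u, w} = {?p ! j, ?p ! Suc j}" "Suc j < length ?p"
        using P(1) e by (auto simp: is_walk_def remove_verts_def)
      then show ?thesis
        using idx_nth[of j] idx_nth[of "Suc j"] that by (auto simp: pos_def doubleton_eq_iff)
    qed
    moreover have "w \<notin> ?L \<and> pos u = pos w" if "u \<in> ?L"
      using two_leaves[OF e that] nb[OF that e] that by (simp add: pos_def)
    moreover have "u \<notin> ?L \<and> pos u = pos w" if "w \<in> ?L"
      using two_leaves[OF e(1) e' that] nb[OF that e(1) e'] that by (simp add: pos_def)
    ultimately show ?thesis by blast
  qed
  have col: "c w = (\<not> c u)" if "e \<in> edges G" "ends G e = {u, w}" for e u w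
    using edge[OF that] by (auto simp: c_def)
  \<comment> \<open>The next three facts locate the other end of an edge at \<open>u\<close>; the
    four cases of the crossing condition follow by comparing them.\<close>
  have leaf_nb: "x w = pos u * N" if "e \<in> edges G" "ends G e = {u, w}" "u \<in> ?L" for e u w
    using edge[OF that(1,2)] that(3) by (auto simp: x_def off_def)
  have upper: "x w \<le> Suc (pos u) * N" if "e \<in> edges G" "ends G e = {u, w}" "u \<notin> ?L" for e u w
    using edge[OF that(1,2)] that(3) off[of w] by (auto simp: x_def off_def)
  have lower: "k * N \<le> x w" if "e \<in> edges G" "ends G e = {u, w}" "k < pos u" for e u w k
  proof -
    have "k \<le> pos w" using edge[OF that(1,2)] that(3) by auto
    then show ?thesis by (simp add: x_def trans_le_add1)
  qed
  have "x w \<le> x w'"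
    if e: "e \<in> edges G" "ends G e = {u, w}" and e': "e' \<in> edges G" "ends G e' = {u', w'}"
      and c: "c u = c u'" and less: "x u < x u'" for e e' u w u' w'
  proof -
    have pos: "pos u \<le> pos u'"
    proof (rule ccontr)
      assume "\<not> pos u \<le> pos u'"
      then have "Suc (pos u') * N \<le> pos u * N" by (intro mult_le_mono1) simp
      moreover have "off u' < N" using edge[OF e'] off by blast
      ultimately show False using less by (simp add: x_def)
    qed
    consider "u \<in> ?L" "u' \<in> ?L" | "u \<in> ?L" "u' \<notin> ?L" | "u \<notin> ?L" "u' \<in> ?L" | "u \<notin> ?L" "u' \<notin> ?L"
      by blast
    then show ?thesis
    proof cases
      case 1
      then show ?thesis
        using leaf_nb[OF e] leaf_nb[OF e'] pos by simp
    next
      case 2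
      \<comment> \<open>A leaf and a spine vertex of the same colour have positions of opposite
        parity.\<close>
      then have "pos u \<noteq> pos u'" using c by (auto simp: c_def)
      then show ?thesis
        using 2 leaf_nb[OF e] lower[OF e', of "pos u"] pos by simp
    next
      case 3
      then have "pos u \<noteq> pos u'" using c by (auto simp: c_def)
      then have "Suc (pos u) * N \<le> pos u' * N" using pos by (intro mult_le_mono1) simp
      then show ?thesis
        using upper[OF e 3(1)] leaf_nb[OF e' 3(2)] by simp
    next
      case 4
      then have "pos u \<noteq> pos u'" using less by (auto simp: x_def off_def)
      moreover have "even (pos u) = even (pos u')" using c 4 by (auto simp: c_def)
      \<comment> \<open>Distinct positions of equal parity leave a gap of at least two, so both
        bounds meet at \<open>Suc (pos u) * N\<close>.\<close>
      ultimately have "Suc (pos u) < pos u'"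
        using pos by (metis even_Suc le_neq_implies_less Suc_lessI)
      then show ?thesis
        using upper[OF e 4(1)] lower[OF e', of "Suc (pos u)"] by simp
    qed
  qed
  with inj col have "noncrossing_layout G c x"
    unfolding noncrossing_layout_def by blast
  then show ?thesis by blast
qed

text \<open>Two adjacent leaves leave room for a single edge only. If all vertices are leaves but
  none are adjacent, there are no edges and any injection works. Otherwise there is a spine.\<close>

lemma caterpillar_noncrossing_layout:
  assumes "is_caterpillar G" and "finite (verts G)"
  shows "\<exists>c x. noncrossing_layout G c x"
proof (cases "\<exists>e u w. e \<in> edges G \<and> ends G e = {u, w} \<and> u \<in> leaves G \<and> w \<in> leaves G")
  case True
  then obtain e u w where "e \<in> edges G" "ends G e = {u, w}" "u \<in> leaves G" "w \<in> leaves G"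
    by blast
  moreover have tree: "is_tree G" using assms by (simp add: is_caterpillar_def)
  ultimately have "verts G \<subseteq> {u, w}"
    by (intro connected_leaf_edge_verts) (auto simp: is_tree_def)
  with tree show ?thesis by (blast intro: single_edge_layout)
next
  case False
  have tree: "is_tree G" and path: "is_path_graph (remove_verts G (leaves G))"
    using assms by (auto simp: is_caterpillar_def)
  show ?thesis
  proof (cases "verts G \<subseteq> leaves G")
    case True
    have "edges G = {}"
    proof (rule ccontr)
      assume "edges G \<noteq> {}"
      then obtain e where e: "e \<in> edges G" by blast
      then have "card (ends G e) = 1 \<or> card (ends G e) = 2" and sub: "ends G e \<subseteq> verts G"
        using tree by (auto simp: is_tree_def wf_ugraph_def)
      then obtain u w where uw: "ends G e = {u, w}"
        by (metis card_1_singletonE card_2_iff insert_absorb2)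
      with sub True have "u \<in> leaves G" "w \<in> leaves G" by auto
      with e uw False show False by blast
    qed
    moreover obtain g :: "'a \<Rightarrow> nat" where "inj_on g (verts G)"
      using finite_imp_inj_to_nat_seg[OF assms(2)] by auto
    ultimately show ?thesis unfolding noncrossing_layout_def by blast
  next
    case nonempty: False
    \<comment> \<open>This excludes the empty alternative in \<open>is_path_graph\<close>.\<close>
    then have "verts (remove_verts G (leaves G)) \<noteq> {}"
      by (auto simp: remove_verts_def)
    with path obtain P where "is_walk (remove_verts G (leaves G)) P" "distinct (wverts P)"
      "set (wverts P) = verts (remove_verts G (leaves G))"
      "set (wedges P) = edges (remove_verts G (leaves G))"
      unfolding is_path_graph_def by blast
    moreover have "verts (remove_verts G (leaves G)) = verts G - leaves G"
      by (simp add: remove_verts_def)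
    ultimately show ?thesis
      using caterpillar_spine_layout[OF assms(2) tree] False by metis
  qed
qed

theorem theorem5:
  fixes G :: "('v, 'e) ugraph" and W :: "('v, 'e) walk"
  assumes "wf_ugraph G"
    and "closed_walk G W"
    and "caterpillar_walk G W"
  shows "\<forall>s \<in> {1..walk_length W div 2}.
           \<exists>U. subwalk_of_closed U W \<and> closed_walk G U \<and> walk_length U = 2 * s"
proof
  fix s assume s: "s \<in> {1..walk_length W div 2}"
  then have r: "0 < walk_length W" and le: "2 * s \<le> walk_length W" by auto
  \<comment> \<open>The layout is taken of the graph traced by \<open>W\<close>, which is finite
    even if \<open>G\<close> is not.\<close>
  have "finite (verts (underlying_graph G W))" by (simp add: underlying_graph_def)
  with assms(3) obtain c x where "noncrossing_layout (underlying_graph G W) c x"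
    using caterpillar_noncrossing_layout unfolding caterpillar_walk_def by blast
  from noncrossing_layout_return[OF assms(2) r this, of s] obtain i where
    i: "i < walk_length W" "wverts W ! (i mod walk_length W) =
      wverts W ! ((i + 2 * s) mod walk_length W)" by blast
  let ?U = "closed_walk_segment W i (2 * s)"
  have "subwalk_of_closed ?U W"
    using i(1) le unfolding subwalk_of_closed_def by (auto intro: less_imp_le)
  moreover have "closed_walk G ?U"
    using closed_walk_segment_closed[OF assms(2) r i(2)] .
  ultimately show "\<exists>U. subwalk_of_closed U W \<and> closed_walk G U \<and> walk_length U = 2 * s"
    by (intro exI[of _ ?U]) simp
qed

end
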